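(* Let $s^{\triangleleft}_m(\mathcal{L}_n)$ be the number of normal subgroups of $\mathcal{L}_n$ of index smaller than or equal to $m$. Then $$\limsup_{m\to\infty}\frac{\log s^{\triangleleft}_m(\mathcal{L}_n)}{\log m}\le n .$$
   Context: $p$ is a fixed prime, $n\ge 1$. $\mathcal{L}_n=(\mathbb{Z}/p\mathbb{Z})^n\wr\mathbb{Z}=\left(\bigoplus_{\mathbb{Z}}(\mathbb{Z}/p\mathbb{Z})^n\right)\rtimes\mathbb{Z}$, where the generator of $\mathbb{Z}$ acts by the shift by one. *)

theory Defs
  imports "HOL-Algebra.Algebra" "HOL-Analysis.Analysis" "HOL-Computational_Algebra.Primes"
begin

definition semidirect_product ::
    "('h, 'x) monoid_scheme \<Rightarrow> ('k, 'y) monoid_scheme \<Rightarrow> ('k \<Rightarrow> 'h \<Rightarrow> 'h) \<Rightarrow> ('h \<times> 'k) monoid" where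
  "semidirect_product H K \<phi> =
     \<lparr>carrier = carrier H \<times> carrier K,
      monoid.mult = (\<lambda>(a, k) (b, l). (a \<otimes>\<^bsub>H\<^esub> \<phi> k b, k \<otimes>\<^bsub>K\<^esub> l)),
      one = (\<one>\<^bsub>H\<^esub>, \<one>\<^bsub>K\<^esub>)\<rparr>"

lemma group_semidirect_product:
  assumes H: "group H" and K: "group K"
    and hom: "\<And>k. k \<in> carrier K \<Longrightarrow> \<phi> k \<in> hom H H"
    and one: "\<And>a. a \<in> carrier H \<Longrightarrow> \<phi> \<one>\<^bsub>K\<^esub> a = a"
    and mult: "\<And>k l a. k \<in> carrier K \<Longrightarrow> l \<in> carrier K \<Longrightarrow> a \<in> carrier H \<Longrightarrow>
                 \<phi> (k \<otimes>\<^bsub>K\<^esub> l) a = \<phi> k (\<phi> l a)"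
  shows "group (semidirect_product H K \<phi>)"
proof -
  interpret H: group H by fact
  interpret K: group K by fact
  have closed: "\<phi> k a \<in> carrier H" if "k \<in> carrier K" "a \<in> carrier H" for k a
    using hom[OF that(1)] that(2) by (auto simp: hom_def)
  have distr: "\<phi> k (a \<otimes>\<^bsub>H\<^esub> b) = \<phi> k a \<otimes>\<^bsub>H\<^esub> \<phi> k b"
    if "k \<in> carrier K" "a \<in> carrier H" "b \<in> carrier H" for k a b
    using hom[OF that(1)] that(2,3) by (auto simp: hom_def)
  show ?thesis
  proof (rule groupI)
    fix x assume "x \<in> carrier (semidirect_product H K \<phi>)"
    then obtain a k where x: "x = (a, k)" and a: "a \<in> carrier H" and k: "k \<in> carrier K"
      by (auto simp: semidirect_product_def)
    define y where "y = (\<phi> (inv\<^bsub>K\<^esub> k) (inv\<^bsub>H\<^esub> a), inv\<^bsub>K\<^esub> k)"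
    have "\<phi> (inv\<^bsub>K\<^esub> k) (inv\<^bsub>H\<^esub> a) \<otimes>\<^bsub>H\<^esub> \<phi> (inv\<^bsub>K\<^esub> k) a = \<phi> (inv\<^bsub>K\<^esub> k) \<one>\<^bsub>H\<^esub>"
      using a k distr[of "inv\<^bsub>K\<^esub> k" "inv\<^bsub>H\<^esub> a" a] by simp
    also have "\<dots> = \<one>\<^bsub>H\<^esub>"
      using hom_one[OF hom H H] k by simp
    finally show "\<exists>y\<in>carrier (semidirect_product H K \<phi>).
        y \<otimes>\<^bsub>semidirect_product H K \<phi>\<^esub> x = \<one>\<^bsub>semidirect_product H K \<phi>\<^esub>"
      using a k closed by (intro bexI[of _ y]) (auto simp: semidirect_product_def x y_def)
  qed (auto simp: semidirect_product_def closed distr one mult H.m_assoc K.m_assoc)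
qed

definition shift :: "int \<Rightarrow> (int \<Rightarrow> 'a) \<Rightarrow> int \<Rightarrow> 'a" where
  "shift k f = (\<lambda>i. f (i - k))"

(* A \<wr> \<int>; sum_group is the restricted product, i.e. the direct sum. *)
definition wreath_int :: "('a, 'x) monoid_scheme \<Rightarrow> ((int \<Rightarrow> 'a) \<times> int) monoid" where
  "wreath_int A = semidirect_product (sum_group UNIV (\<lambda>_. A)) integer_group shift"

definition lamplighter :: "nat \<Rightarrow> nat \<Rightarrow> ((int \<Rightarrow> nat \<Rightarrow> int) \<times> int) monoid" where
  "lamplighter p n = wreath_int (product_group {..<n} (\<lambda>_. integer_mod_group p))"

lemma group_wreath_int:
  assumes "group A"
  shows "group (wreath_int A)"
  unfolding wreath_int_def
proof (rule group_semidirect_product)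
  fix k
  have "shift k f \<in> carrier (sum_group UNIV (\<lambda>_. A))"
    if "f \<in> carrier (sum_group UNIV (\<lambda>_::int. A))" for f
  proof -
    have fin: "finite {i. f i \<noteq> \<one>\<^bsub>A\<^esub>}" and f: "\<And>i. f i \<in> carrier A"
      using that assms by (auto simp: carrier_sum_group)
    have "finite ((\<lambda>i. i + k) ` {i. f i \<noteq> \<one>\<^bsub>A\<^esub>})"
      using fin by simp
    moreover have "{i. shift k f i \<noteq> \<one>\<^bsub>A\<^esub>} \<subseteq> (\<lambda>i. i + k) ` {i. f i \<noteq> \<one>\<^bsub>A\<^esub>}"
    proof
      fix i assume "i \<in> {i. shift k f i \<noteq> \<one>\<^bsub>A\<^esub>}"
      then show "i \<in> (\<lambda>i. i + k) ` {i. f i \<noteq> \<one>\<^bsub>A\<^esub>}"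
        by (intro image_eqI[of _ _ "i - k"]) (auto simp: shift_def)
    qed
    ultimately have "finite {i. shift k f i \<noteq> \<one>\<^bsub>A\<^esub>}"
      by (rule rev_finite_subset)
    with f assms show ?thesis
      by (auto simp: carrier_sum_group shift_def PiE_iff)
  qed
  then show "shift k \<in> hom (sum_group UNIV (\<lambda>_. A)) (sum_group UNIV (\<lambda>_. A))"
    by (intro homI) (simp_all add: shift_def fun_eq_iff)
qed (use assms in \<open>simp_all add: shift_def diff_diff_eq add.commute\<close>)

lemma group_lamplighter: "group (lamplighter p n)"
  unfolding lamplighter_def by (intro group_wreath_int product_group) simp

(* card is 0 on infinite sets, so finiteness of the index is required explicitly. *)
definition normal_subgroups_index_le :: "('a, 'x) monoid_scheme \<Rightarrow> nat \<Rightarrow> 'a set set" where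
  "normal_subgroups_index_le G m =
     {N. N \<lhd> G \<and> finite (rcosets\<^bsub>G\<^esub> N) \<and> card (rcosets\<^bsub>G\<^esub> N) \<le> m}"

definition normal_subgroup_count :: "('a, 'x) monoid_scheme \<Rightarrow> nat \<Rightarrow> nat" where
  "normal_subgroup_count G m = card (normal_subgroups_index_le G m)"

end

theory Submission
  imports Defs "HOL-Number_Theory.Cong" "HOL-Real_Asymp.Real_Asymp"
begin

text \<open>
  Write \<open>R = F\<^sub>p[x, 1/x]\<close>, so that the base group is \<open>R\<^sup>n\<close> with basis \<open>e\<^sub>0, \<dots>, e\<^sub>n\<^sub>-\<^sub>1\<close>. A normal subgroup
  \<open>N\<close> of finite index meets the base group in a submodule \<open>M\<close> and projects onto \<open>k\<int>\<close> for some
  \<open>k > 0\<close>. Take a maximal \<open>d\<close> such that the monomials \<open>x\<^sup>i e\<^sub>l\<close> with \<open>0 \<le> i < d l\<close> are independent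
  modulo \<open>M\<close>, and let \<open>W\<close> be their span. By maximality \<open>x\<close> to the power \<open>d l\<close> times \<open>e\<^sub>l\<close> is congruent modulo \<open>M\<close>
  to some \<open>r l \<in> W\<close>, and these relations determine \<open>M\<close>. Some \<open>w \<in> W\<close> has \<open>(w, k) \<in> N\<close>, and
  normality forces \<open>(x - 1) w \<in> M\<close>, which determines \<open>w\<close> from its \<open>n\<close> top coefficients.

  With \<open>D = \<Sum>l. d l\<close> the index is at least \<open>k p\<^sup>D\<close>, and for given \<open>D\<close> there are at most
  \<open>(m / p\<^sup>D) (D + 1)\<^sup>n (p\<^sup>D)\<^sup>n p\<^sup>n\<close> choices of \<open>(k, d, r)\<close> and the top coefficients. As \<open>n \<ge> 1\<close>
  and \<open>p\<^sup>D \<le> m\<close>, this is at most \<open>(D + 1)\<^sup>n p\<^sup>n m\<^sup>n\<close>, and only \<open>O(log m)\<close> values of \<open>D\<close> occur.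
\<close>

section \<open>Auxiliary facts on cosets, counting and logarithms\<close>

lemma (in group) r_coset_eq_imp_mult_inv_mem:
  assumes "subgroup H G" "x \<in> carrier G" "y \<in> carrier G" "H #> x = H #> y"
  shows "x \<otimes> inv y \<in> H"
  using assms by (metis rcos_self subgroup.rcos_module is_group)

lemma set_multI: "h \<in> H \<Longrightarrow> k \<in> K \<Longrightarrow> h \<otimes>\<^bsub>G\<^esub> k \<in> H <#>\<^bsub>G\<^esub> K"
  by (auto simp: set_mult_def)

text \<open>Choosing one related \<open>x\<close> for each \<open>y\<close> gives an injection of
  \<open>B\<close> into \<open>A\<close>. With \<open>encodes\<close> as the relation, this bounds
  the number of subgroups by the number of codes.\<close>

lemma finite_card_le_of_relation:
  assumes A: "finite A" and ex: "\<And>y. y \<in> B \<Longrightarrow> \<exists>x\<in>A. R x y"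
    and unique: "\<And>x y z. R x y \<Longrightarrow> R x z \<Longrightarrow> y = z"
  shows "finite B \<and> card B \<le> card A"
proof -
  obtain f where f: "\<And>y. y \<in> B \<Longrightarrow> f y \<in> A \<and> R (f y) y"
    using ex by metis
  have "inj_on f B"
    using f unique by (metis inj_onI)
  moreover have "f ` B \<subseteq> A"
    using f by blast
  ultimately show ?thesis
    using A by (meson card_inj_on_le inj_on_finite)
qed

text \<open>For \<open>a = 0\<close> the convention \<open>ln 0 = 0\<close> applies, and
  \<open>ln b\<close> is nonnegative.\<close>

lemma ln_real_nat_mono: "a \<le> b \<Longrightarrow> 1 \<le> b \<Longrightarrow> ln (real a) \<le> ln (real b)"
  by (cases "a = 0") simp_all

subsection \<open>The base group\<close>

locale prime_lamplighter =
  fixes p n :: nat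
  assumes prime_p: "Factorial_Ring.prime p"
begin

text \<open>The module \<open>R^n\<close>, written multiplicatively: \<open>f i l\<close> is the
  coefficient of \<open>x^i e_l\<close>, and \<open>shift k\<close> is multiplication by
  \<open>x^k\<close>.\<close>

definition base :: "(int \<Rightarrow> nat \<Rightarrow> int) monoid" where
  "base = sum_group UNIV (\<lambda>_. product_group {..<n} (\<lambda>_. integer_mod_group p))"

text \<open>The span over the field with \<open>p\<close> elements of the monomials
  \<open>x^i e_l\<close> with \<open>(i, l)\<close> in \<open>P\<close>.\<close>

definition supported :: "(int \<times> nat) set \<Rightarrow> (int \<Rightarrow> nat \<Rightarrow> int) set" where
  "supported P = {f \<in> carrier base. \<forall>i. \<forall>l<n. f i l \<noteq> 0 \<longrightarrow> (i, l) \<in> P}"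

definition monomial :: "int \<Rightarrow> nat \<Rightarrow> int \<Rightarrow> nat \<Rightarrow> int" where
  "monomial i l = (\<lambda>j. \<lambda>m\<in>{..<n}. if j = i \<and> m = l then 1 else 0)"

lemma p_gt_1: "p > 1"
  using prime_p by (rule prime_gt_1_nat)

text \<open>The direct sum asks for finitely many nonzero rows \<open>f i\<close>; as each row has
  only \<open>n\<close> entries, this amounts to finitely many nonzero coefficients.\<close>

lemma base_carrier_iff:
  "f \<in> carrier base \<longleftrightarrow>
     (\<forall>i. f i \<in> extensional {..<n} \<and> (\<forall>l<n. 0 \<le> f i l \<and> f i l < int p)) \<and>
     finite {x. snd x < n \<and> f (fst x) (snd x) \<noteq> 0}"
proof -
  let ?P = "\<forall>i. f i \<in> extensional {..<n} \<and> (\<forall>l<n. 0 \<le> f i l \<and> f i l < int p)"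
  let ?S = "{x. snd x < n \<and> f (fst x) (snd x) \<noteq> 0}"
  let ?T = "{i. f i \<noteq> (\<lambda>l\<in>{..<n}. 0)}"
  have "f \<in> carrier base \<longleftrightarrow> ?P \<and> finite ?T"
    using p_gt_1
    by (auto simp: base_def carrier_sum_group carrier_integer_mod_group PiE_iff)
  also have "\<dots> \<longleftrightarrow> ?P \<and> finite ?S"
  proof (rule conj_cong[OF refl])
    assume P: ?P
    have "?S \<subseteq> ?T \<times> {..<n}"
    proof
      fix x assume "x \<in> ?S"
      then have "snd x < n" "f (fst x) (snd x) \<noteq> (\<lambda>l\<in>{..<n}. 0) (snd x)"
        by simp_all
      then show "x \<in> ?T \<times> {..<n}"
        by (cases x) auto
    qed
    moreover have "?T \<subseteq> fst ` ?S"
    proof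
      fix i assume "i \<in> ?T"
      then obtain l where "f i l \<noteq> (if l < n then 0 else undefined)"
        by (auto simp: fun_eq_iff restrict_def)
      moreover have "f i l = undefined" if "\<not> l < n"
        using P that by (auto simp: extensional_def)
      ultimately have "(i, l) \<in> ?S"
        by (cases "l < n") auto
      then show "i \<in> fst ` ?S"
        by (rule image_eqI[rotated]) simp
    qed
    ultimately show "finite ?T = finite ?S"
      by (meson finite_SigmaI finite_imageI finite_lessThan finite_subset)
  qed
  finally show ?thesis .
qed

sublocale base: comm_group base
proof -
  have "group base"
    unfolding base_def by (intro sum_group product_group) simp
  then show "comm_group base"
    by (rule group.group_comm_groupI)
      (auto simp: base_def fun_eq_iff restrict_def add.commute)
qed

lemma base_eqI:
  assumes "f \<in> carrier base" "g \<in> carrier base" "\<And>i l. l < n \<Longrightarrow> f i l = g i l"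
  shows "f = g"
proof (intro ext)
  fix i l
  have "f i \<in> extensional {..<n}" "g i \<in> extensional {..<n}"
    using assms(1,2) by (simp_all add: base_carrier_iff)
  then show "f i l = g i l"
    using assms(3) by (cases "l < n") (auto simp: extensional_def)
qed

lemma base_mult: "l < n \<Longrightarrow> (f \<otimes>\<^bsub>base\<^esub> g) i l = (f i l + g i l) mod int p"
  by (simp add: base_def)

lemma base_one: "l < n \<Longrightarrow> \<one>\<^bsub>base\<^esub> i l = 0"
  by (simp add: base_def)

lemma base_inv: "f \<in> carrier base \<Longrightarrow> l < n \<Longrightarrow> (inv\<^bsub>base\<^esub> f) i l = (- f i l) mod int p"
proof -
  assume f: "f \<in> carrier base" and l: "l < n"
  have "((inv\<^bsub>base\<^esub> f) i l + f i l) mod int p = 0"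
    using f l base_mult[of l "inv\<^bsub>base\<^esub> f" f i] base_one[of l i] by simp
  moreover have "(inv\<^bsub>base\<^esub> f) i l mod int p = (inv\<^bsub>base\<^esub> f) i l"
    using base_carrier_iff[of "inv\<^bsub>base\<^esub> f"] f l by simp
  ultimately show ?thesis
    by (metis add.right_neutral add_diff_cancel_right' diff_0 mod_diff_left_eq)
qed

lemma base_pow:
  assumes "f \<in> carrier base" "l < n"
  shows "(f [^]\<^bsub>base\<^esub> (c :: nat)) i l = (int c * f i l) mod int p"
proof (induction c)
  case (Suc c)
  have "(f [^]\<^bsub>base\<^esub> Suc c) i l = ((int c * f i l) mod int p + f i l) mod int p"
    using assms Suc by (simp add: base_mult)
  then show ?case
    by (simp only: mod_add_left_eq) (simp add: algebra_simps)
qed (use assms in \<open>simp add: base_one\<close>)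

lemma base_range: "f \<in> carrier base \<Longrightarrow> l < n \<Longrightarrow> f i l mod int p = f i l"
  by (simp add: base_carrier_iff)

lemma shift_carrier [simp]: "shift k f \<in> carrier base" if f: "f \<in> carrier base"
proof -
  have "{x. snd x < n \<and> shift k f (fst x) (snd x) \<noteq> 0}
      \<subseteq> (\<lambda>x. (fst x + k, snd x)) ` {x. snd x < n \<and> f (fst x) (snd x) \<noteq> 0}"
  proof
    fix x assume "x \<in> {x. snd x < n \<and> shift k f (fst x) (snd x) \<noteq> 0}"
    then show "x \<in> (\<lambda>x. (fst x + k, snd x)) ` {x. snd x < n \<and> f (fst x) (snd x) \<noteq> 0}"
      by (intro image_eqI[of _ _ "(fst x - k, snd x)"]) (auto simp: shift_def)
  qed
  moreover have "finite {x. snd x < n \<and> f (fst x) (snd x) \<noteq> 0}"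
    using f by (simp add: base_carrier_iff)
  ultimately have "finite {x. snd x < n \<and> shift k f (fst x) (snd x) \<noteq> 0}"
    by (meson finite_imageI finite_subset)
  then show ?thesis
    using f by (simp add: base_carrier_iff shift_def)
qed

lemma shift_mult: "shift k (f \<otimes>\<^bsub>base\<^esub> g) = shift k f \<otimes>\<^bsub>base\<^esub> shift k g"
  by (simp add: base_def shift_def fun_eq_iff)

lemma shift_0 [simp]: "shift 0 f = f"
  by (simp add: shift_def)

lemma shift_shift [simp]: "shift j (shift k f) = shift (j + k) f"
  by (simp add: shift_def diff_diff_eq add.commute)

lemma shift_inv: "f \<in> carrier base \<Longrightarrow> shift k (inv\<^bsub>base\<^esub> f) = inv\<^bsub>base\<^esub> (shift k f)"
proof -
  assume f: "f \<in> carrier base"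
  show ?thesis
    using f by (intro base_eqI) (auto simp: base_inv, simp_all add: shift_def base_inv)
qed

lemma shift_one [simp]: "shift k \<one>\<^bsub>base\<^esub> = \<one>\<^bsub>base\<^esub>"
  by (simp add: shift_def base_def restrict_def)

lemma monomial_carrier [simp]: "monomial i l \<in> carrier base"
proof -
  have "{x. snd x < n \<and> monomial i l (fst x) (snd x) \<noteq> 0} \<subseteq> {(i, l)}"
    by (auto simp: monomial_def split: if_splits)
  then have "finite {x. snd x < n \<and> monomial i l (fst x) (snd x) \<noteq> 0}"
    using finite_subset by blast
  then show ?thesis
    using p_gt_1 by (auto simp: base_carrier_iff monomial_def)
qed

lemma shift_monomial: "shift k (monomial i l) = monomial (i + k) l"
  by (auto simp: shift_def monomial_def fun_eq_iff restrict_def)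

lemma supported_subset: "supported P \<subseteq> carrier base"
  by (auto simp: supported_def)

lemma subgroup_supported: "subgroup (supported P) base"
proof (rule base.subgroupI)
  have "\<one>\<^bsub>base\<^esub> \<in> supported P"
    by (auto simp: supported_def base_one)
  then show "supported P \<noteq> {}" by blast
  show "inv\<^bsub>base\<^esub> f \<in> supported P" if "f \<in> supported P" for f
    using that by (auto simp: supported_def base_inv) (metis mod_0 minus_zero)
  show "f \<otimes>\<^bsub>base\<^esub> g \<in> supported P" if "f \<in> supported P" "g \<in> supported P" for f g
    using that by (auto simp: supported_def base_mult) (metis mod_0 add_0)
qed (rule supported_subset)

lemma monomial_supported: "(i, l) \<in> P \<Longrightarrow> monomial i l \<in> supported P"
  by (auto simp: supported_def) (auto simp: monomial_def split: if_splits)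

text \<open>Induction on the number of nonzero coefficients: dividing by a power of one monomial
  clears a coefficient and changes no other.\<close>

lemma supported_subset_subgroup:
  assumes H: "subgroup H base"
    and mono: "\<And>i l. (i, l) \<in> P \<Longrightarrow> l < n \<Longrightarrow> monomial i l \<in> H"
  shows "supported P \<subseteq> H"
proof
  fix f assume "f \<in> supported P"
  then show "f \<in> H"
  proof (induction "card {x. snd x < n \<and> f (fst x) (snd x) \<noteq> 0}" arbitrary: f rule: less_induct)
    case less
    let ?S = "\<lambda>f. {x. snd x < n \<and> f (fst x) (snd x) \<noteq> 0}"
    have f: "f \<in> carrier base"
      using less.prems supported_subset by blast
    have fin: "finite (?S f)"
      using f base_carrier_iff by blast
    show ?case
    proof (cases "?S f = {}")
      case True
      have "f = \<one>\<^bsub>base\<^esub>"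
        using f True by (intro base_eqI) (auto simp: base_one)
      then show ?thesis
        using H by (simp add: subgroup.one_closed)
    next
      case False
      then obtain i l where il: "l < n" "f i l \<noteq> 0" by auto
      then have P: "(i, l) \<in> P"
        using less.prems by (auto simp: supported_def)
      \<comment> \<open>Scalar multiplication is a power in this notation; the coefficient lies
        between 0 and \<open>p - 1\<close>, so \<open>nat\<close> loses nothing.\<close>
      define h where "h = monomial i l [^]\<^bsub>base\<^esub> nat (f i l)"
      have h: "h \<in> carrier base"
        by (simp add: h_def)
      have hH: "h \<in> H"
        using base.subgroup_int_pow_closed[OF H mono[OF P il(1)], of "int (nat (f i l))"]
        unfolding h_def int_pow_int .
      have h_eq: "h j m = (if j = i \<and> m = l then f i l else 0)" if "m < n" for j m
      proof -
        have "h j m = (int (nat (f i l)) * monomial i l j m) mod int p"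
          unfolding h_def using that by (intro base_pow) simp
        moreover have "0 \<le> f i l" "f i l < int p"
          using f il(1) by (simp_all add: base_carrier_iff)
        ultimately show ?thesis
          using that by (simp add: monomial_def)
      qed
      define g where "g = f \<otimes>\<^bsub>base\<^esub> inv\<^bsub>base\<^esub> h"
      have g: "g \<in> carrier base"
        using f h by (simp add: g_def)
      have g_eq: "g j m = (if j = i \<and> m = l then 0 else f j m)" if "m < n" for j m
        using f h that by (auto simp: g_def base_mult base_inv h_eq mod_add_right_eq base_range)
      have "?S g \<subseteq> ?S f - {(i, l)}"
        by (auto simp: g_eq split: if_splits)
      moreover have "(i, l) \<in> ?S f"
        using il by simp
      ultimately have "card (?S g) < card (?S f)"
        using fin by (intro psubset_card_mono) auto
      moreover have "g \<in> supported P"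
        using less.prems g by (auto simp: supported_def g_eq)
      ultimately have "g \<in> H"
        by (rule less.hyps)
      then have "g \<otimes>\<^bsub>base\<^esub> h \<in> H"
        using hH by (rule subgroup.m_closed[OF H])
      then show ?thesis
        using f h by (simp add: g_def base.m_assoc)
    qed
  qed
qed

text \<open>The coefficients at \<open>P\<close> determine an element and can be any residues;
  extending them by zero stays in the base group because \<open>P\<close> is finite.\<close>

lemma card_supported:
  assumes P: "finite P" "P \<subseteq> UNIV \<times> {..<n}"
  shows "finite (supported P)" "card (supported P) = p ^ card P"
proof -
  have eq: "f i l = (if l < n then (if (i, l) \<in> P then f i l else 0) else undefined)"
    if "f \<in> supported P" for f i l
    using that by (auto simp: supported_def base_carrier_iff extensional_def)
  have "bij_betw (\<lambda>f. \<lambda>x\<in>P. f (fst x) (snd x)) (supported P) (P \<rightarrow>\<^sub>E {0..<int p})"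
  proof (rule bij_betw_byWitness)
    let ?h = "\<lambda>g i. \<lambda>l\<in>{..<n}. if (i, l) \<in> P then g (i, l) else (0 :: int)"
    show "\<forall>f\<in>supported P. ?h (\<lambda>x\<in>P. f (fst x) (snd x)) = f"
    proof (intro ballI ext)
      fix f i l assume "f \<in> supported P"
      from eq[OF this, of i l] show "?h (\<lambda>x\<in>P. f (fst x) (snd x)) i l = f i l"
        by (auto simp: restrict_def)
    qed
    show "\<forall>g\<in>P \<rightarrow>\<^sub>E {0..<int p}. (\<lambda>x\<in>P. ?h g (fst x) (snd x)) = g"
      using P by (auto simp: fun_eq_iff restrict_def PiE_iff extensional_def)
    show "(\<lambda>f. \<lambda>x\<in>P. f (fst x) (snd x)) ` supported P \<subseteq> P \<rightarrow>\<^sub>E {0..<int p}"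
    proof
      fix g assume "g \<in> (\<lambda>f. \<lambda>x\<in>P. f (fst x) (snd x)) ` supported P"
      then obtain f where "f \<in> carrier base" "g = (\<lambda>x\<in>P. f (fst x) (snd x))"
        by (auto simp: supported_def)
      with P show "g \<in> P \<rightarrow>\<^sub>E {0..<int p}"
        by (auto simp: base_carrier_iff)
    qed
    show "?h ` (P \<rightarrow>\<^sub>E {0..<int p}) \<subseteq> supported P"
    proof
      fix f assume "f \<in> ?h ` (P \<rightarrow>\<^sub>E {0..<int p})"
      then obtain g where g: "g \<in> P \<rightarrow>\<^sub>E {0..<int p}" and f: "f = ?h g" by blast
      have "{x. snd x < n \<and> f (fst x) (snd x) \<noteq> 0} \<subseteq> P"
        by (auto simp: f)
      then have "finite {x. snd x < n \<and> f (fst x) (snd x) \<noteq> 0}"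
        using P finite_subset by blast
      with g p_gt_1 show "f \<in> supported P"
        by (auto simp: supported_def base_carrier_iff f PiE_iff Ball_def)
    qed
  qed
  note bij = this
  show "card (supported P) = p ^ card P"
    using bij_betw_same_card[OF bij] P by (simp add: card_PiE)
  show "finite (supported P)"
    using bij_betw_finite[OF bij] P by (simp add: finite_PiE)
qed

section \<open>Polynomial vectors of bounded degree and division with remainder\<close>

definition box :: "(nat \<Rightarrow> nat) \<Rightarrow> (int \<times> nat) set" where
  "box d = {(i, l). l < n \<and> 0 \<le> i \<and> i < int (d l)}"

lemma box_eq: "box d = (\<lambda>(l, i). (int i, l)) ` (SIGMA l:{..<n}. {..<d l})"
proof
  show "box d \<subseteq> (\<lambda>(l, i). (int i, l)) ` (SIGMA l:{..<n}. {..<d l})"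
  proof
    fix x assume "x \<in> box d"
    then obtain i l where "x = (i, l)" "l < n" "0 \<le> i" "i < int (d l)"
      by (auto simp: box_def)
    then show "x \<in> (\<lambda>(l, i). (int i, l)) ` (SIGMA l:{..<n}. {..<d l})"
      by (intro image_eqI[of _ _ "(l, nat i)"]) auto
  qed
  show "(\<lambda>(l, i). (int i, l)) ` (SIGMA l:{..<n}. {..<d l}) \<subseteq> box d"
    by (rule image_subsetI) (simp add: box_def split_beta Sigma_def, auto)
qed

lemma finite_box: "finite (box d)"
  by (simp add: box_eq)

lemma card_box: "card (box d) = (\<Sum>l<n. d l)"
  unfolding box_eq by (subst card_image) (auto simp: inj_on_def)

lemma card_supported_box:
  "finite (supported (box d))" "card (supported (box d)) = p ^ (\<Sum>l<n. d l)"
proof -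
  have "box d \<subseteq> UNIV \<times> {..<n}"
    by (auto simp: box_def)
  with card_supported[of "box d"] finite_box card_box
  show "finite (supported (box d))" "card (supported (box d)) = p ^ (\<Sum>l<n. d l)"
    by auto
qed

lemma shift_supported_nonneg:
  assumes f: "f \<in> carrier base"
  obtains k where "shift (int k) f \<in> supported {x. 0 \<le> fst x}"
proof -
  let ?S = "{x. snd x < n \<and> f (fst x) (snd x) \<noteq> 0}"
  have fin: "finite ?S"
    using f base_carrier_iff by blast
  \<comment> \<open>The sum of the absolute values of all exponents that occur is a crude bound for
    each of them.\<close>
  define k where "k = nat (\<Sum>x\<in>?S. \<bar>fst x\<bar>)"
  have "0 \<le> i" if "l < n" "shift (int k) f i l \<noteq> 0" for i l
  proof -
    have "(i - int k, l) \<in> ?S"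
      using that by (simp add: shift_def)
    then have "\<bar>i - int k\<bar> \<le> (\<Sum>x\<in>?S. \<bar>fst x\<bar>)"
      using fin member_le_sum[of "(i - int k, l)" ?S "\<lambda>x. \<bar>fst x\<bar>"] by simp
    then show ?thesis
      by (simp add: k_def)
  qed
  with f have "shift (int k) f \<in> supported {x. 0 \<le> fst x}"
    by (auto simp: supported_def)
  then show thesis ..
qed

text \<open>Division with remainder: multiplication by \<open>x\<close> either keeps a box monomial
  in the box or turns it into some \<open>x^(d l) e_l\<close>, which is \<open>r l\<close> modulo
  \<open>K\<close>. Hence \<open>W + K\<close> is closed under \<open>x\<close> and contains all
  polynomial vectors. \<open>K\<close> is kept general because it will also be the intersection of
  two fibres.\<close>

lemma supported_nonneg_subset_set_mult:
  assumes K: "subgroup K base" and shift_K: "\<And>f. f \<in> K \<Longrightarrow> shift 1 f \<in> K"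
    and r: "\<And>l. l < n \<Longrightarrow> r l \<in> supported (box d)"
    and mr: "\<And>l. l < n \<Longrightarrow> monomial (int (d l)) l \<otimes>\<^bsub>base\<^esub> inv\<^bsub>base\<^esub> (r l) \<in> K"
  shows "supported {x. 0 \<le> fst x} \<subseteq> supported (box d) <#>\<^bsub>base\<^esub> K"
proof -
  let ?S = "supported (box d) <#>\<^bsub>base\<^esub> K"
  note W = subgroup_supported[of "box d"]
  have S: "subgroup ?S base"
    by (rule base.mult_subgroups[OF W K])
  have W_S: "supported (box d) \<subseteq> ?S"
  proof
    fix w assume w: "w \<in> supported (box d)"
    then have "w \<otimes>\<^bsub>base\<^esub> \<one>\<^bsub>base\<^esub> = w"
      using supported_subset by (metis base.r_one subsetD)
    then show "w \<in> ?S"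
      using set_multI[OF w subgroup.one_closed[OF K], of base] by simp
  qed
  \<comment> \<open>The boundary case \<open>i = d l\<close> is where the relation for
    \<open>r l\<close> enters.\<close>
  have le: "monomial (int i) l \<in> ?S" if "l < n" "i \<le> d l" for i l
  proof (cases "i = d l")
    case True
    have "r l \<in> carrier base"
      using r[OF that(1)] supported_subset by blast
    then have "monomial (int i) l = r l \<otimes>\<^bsub>base\<^esub> (monomial (int (d l)) l \<otimes>\<^bsub>base\<^esub> inv\<^bsub>base\<^esub> (r l))"
      using True base.m_lcomm[of "r l" "monomial (int (d l)) l" "inv\<^bsub>base\<^esub> (r l)"] by simp
    then show ?thesis
      using set_multI[OF r[OF that(1)] mr[OF that(1)], of base] by simp
  next
    case False
    then have "monomial (int i) l \<in> supported (box d)"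
      using that by (intro monomial_supported) (simp add: box_def)
    then show ?thesis
      using W_S by blast
  qed
  \<comment> \<open>The preimage of \<open>W + K\<close> under \<open>x\<close> is a subgroup, so
    monomials suffice.\<close>
  have shift_W: "supported (box d) \<subseteq> {f \<in> carrier base. shift 1 f \<in> ?S}"
  proof (rule supported_subset_subgroup)
    show "subgroup {f \<in> carrier base. shift 1 f \<in> ?S} base"
    proof (rule base.subgroupI)
      have "\<one>\<^bsub>base\<^esub> \<in> {f \<in> carrier base. shift 1 f \<in> ?S}"
        using subgroup.one_closed[OF S] by simp
      then show "{f \<in> carrier base. shift 1 f \<in> ?S} \<noteq> {}" by blast
    qed (use S in \<open>auto simp: shift_mult shift_inv subgroup.m_closed subgroup.m_inv_closed\<close>)
    fix i l assume "(i, l) \<in> box d" "l < n"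
    then have "monomial (int (nat i + 1)) l \<in> ?S"
      by (intro le) (auto simp: box_def)
    with \<open>(i, l) \<in> box d\<close> show "monomial i l \<in> {f \<in> carrier base. shift 1 f \<in> ?S}"
      by (simp add: shift_monomial box_def add.commute)
  qed
  have shift_S: "shift 1 f \<in> ?S" if f: "f \<in> ?S" for f
  proof -
    obtain w g where wg: "w \<in> supported (box d)" "g \<in> K" "f = w \<otimes>\<^bsub>base\<^esub> g"
      using f unfolding set_mult_def by blast
    have "\<one>\<^bsub>base\<^esub> \<otimes>\<^bsub>base\<^esub> shift 1 g = shift 1 g"
      using wg(2) shift_K subgroup.subset[OF K] by auto
    then have "shift 1 g \<in> ?S"
      using set_multI[OF subgroup.one_closed[OF W] shift_K[OF wg(2)], of base] by simp
    moreover have "shift 1 w \<in> ?S"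
      using wg(1) shift_W by blast
    ultimately show ?thesis
      unfolding wg(3) shift_mult by (intro subgroup.m_closed[OF S])
  qed
  \<comment> \<open>The start \<open>e_l\<close> is covered by \<open>le\<close> even when
    \<open>d l = 0\<close>, where it lies outside the box.\<close>
  have all: "monomial (int i) l \<in> ?S" if "l < n" for i l
  proof (induction i)
    case 0
    then show ?case using le[OF that, of 0] by simp
  next
    case (Suc i)
    then show ?case
      using shift_S[OF Suc] by (simp add: shift_monomial add.commute)
  qed
  show ?thesis
  proof (rule supported_subset_subgroup[OF S])
    fix i l assume "(i, l) \<in> {x :: int \<times> nat. 0 \<le> fst x}" "l < n"
    then show "monomial i l \<in> ?S"
      using all[of l "nat i"] by simp
  qed
qed

subsection \<open>Subgroups of the lamplighter group\<close>

abbreviation L :: "((int \<Rightarrow> nat \<Rightarrow> int) \<times> int) monoid" where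
  "L \<equiv> lamplighter p n"

lemma L_carrier: "carrier L = carrier base \<times> UNIV"
  and L_mult: "(f, j) \<otimes>\<^bsub>L\<^esub> (g, k) = (f \<otimes>\<^bsub>base\<^esub> shift j g, j + k)"
  and L_one: "\<one>\<^bsub>L\<^esub> = (\<one>\<^bsub>base\<^esub>, 0)"
  by (simp_all add: lamplighter_def wreath_int_def semidirect_product_def base_def)

sublocale L: group L
  by (rule group_lamplighter)

lemma L_inv: "f \<in> carrier base \<Longrightarrow> inv\<^bsub>L\<^esub> (f, k) = (shift (- k) (inv\<^bsub>base\<^esub> f), - k)"
  by (rule L.inv_equality) (simp_all add: L_mult L_one L_carrier flip: shift_mult)

text \<open>The intersection of \<open>N\<close> with the base group; for normal \<open>N\<close> it
  is the submodule \<open>M\<close>.\<close>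

definition fibre :: "((int \<Rightarrow> nat \<Rightarrow> int) \<times> int) set \<Rightarrow> (int \<Rightarrow> nat \<Rightarrow> int) set" where
  "fibre N = {f. (f, 0) \<in> N}"

lemma subgroup_fibre:
  assumes N: "subgroup N L"
  shows "subgroup (fibre N) base"
proof (rule base.subgroupI)
  show sub: "fibre N \<subseteq> carrier base"
    using subgroup.subset[OF N] by (auto simp: fibre_def L_carrier)
  have "\<one>\<^bsub>base\<^esub> \<in> fibre N"
    using subgroup.one_closed[OF N] by (simp add: fibre_def L_one)
  then show "fibre N \<noteq> {}" by blast
  fix f assume f: "f \<in> fibre N"
  then show "inv\<^bsub>base\<^esub> f \<in> fibre N"
    using subgroup.m_inv_closed[OF N, of "(f, 0)"] sub by (auto simp: fibre_def L_inv)
  fix g assume "g \<in> fibre N"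
  with f show "f \<otimes>\<^bsub>base\<^esub> g \<in> fibre N"
    using subgroup.m_closed[OF N, of "(f, 0)" "(g, 0)"] by (simp add: fibre_def L_mult)
qed

text \<open>Conjugation by the translation \<open>(1, k)\<close> multiplies the first component by
  \<open>x^k\<close> and fixes the second, as the integers are abelian.\<close>

lemma normal_shift:
  assumes N: "N \<lhd> L" and f: "(f, j) \<in> N"
  shows "(shift k f, j) \<in> N"
proof -
  have "f \<in> carrier base"
    using f subgroup.subset[OF normal_imp_subgroup[OF N]] by (auto simp: L_carrier)
  then show ?thesis
    using normal.inv_op_closed2[OF N, of "(\<one>\<^bsub>base\<^esub>, k)" "(f, j)"] f
    by (simp add: L_carrier L_mult L_inv)
qed

lemma shift_fibre: "N \<lhd> L \<Longrightarrow> f \<in> fibre N \<Longrightarrow> shift k f \<in> fibre N"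
  using normal_shift by (simp add: fibre_def)

lemma mult_inv_fibre:
  assumes N: "subgroup N L" and "(f, k) \<in> N" "(g, k) \<in> N"
  shows "f \<otimes>\<^bsub>base\<^esub> inv\<^bsub>base\<^esub> g \<in> fibre N"
proof -
  have "g \<in> carrier base"
    using assms(3) subgroup.subset[OF N] by (auto simp: L_carrier)
  moreover have "(f, k) \<otimes>\<^bsub>L\<^esub> inv\<^bsub>L\<^esub> (g, k) \<in> N"
    using assms by (intro subgroup.m_closed subgroup.m_inv_closed)
  ultimately show ?thesis
    by (simp add: fibre_def L_inv L_mult)
qed

section \<open>Projection to the integers, generation, and the index\<close>

lemma ex_multiple_degree:
  assumes H: "subgroup H L" and w: "(w, k) \<in> H"
  shows "\<exists>u. (u, k * j) \<in> H"
proof -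
  have nat: "\<exists>u. (u, k * int i) \<in> H" for i
  proof (induction i)
    case 0
    show ?case
      using subgroup.one_closed[OF H] by (auto simp: L_one)
  next
    case (Suc i)
    then obtain u where "(u, k * int i) \<in> H" ..
    from subgroup.m_closed[OF H w this] show ?case
      by (auto simp: L_mult algebra_simps)
  qed
  show ?thesis
  proof (cases "0 \<le> j")
    case True
    then show ?thesis using nat[of "nat j"] by simp
  next
    case False
    then obtain u where u: "(u, - (k * j)) \<in> H"
      using nat[of "nat (- j)"] by auto
    then have "u \<in> carrier base"
      using subgroup.subset[OF H] by (auto simp: L_carrier)
    then show ?thesis
      using subgroup.m_inv_closed[OF H u] by (auto simp: L_inv)
  qed
qed

text \<open>Among the infinitely many translations two lie in the same coset, so \<open>N\<close>
  contains an element of positive degree. The least such degree divides all others by division with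
  remainder.\<close>

lemma ex_degree:
  assumes N: "subgroup N L" and fin: "finite (rcosets\<^bsub>L\<^esub> N)"
  obtains k v where "k > (0 :: nat)" "(v, int k) \<in> N" "\<And>u j. (u, j) \<in> N \<Longrightarrow> int k dvd j"
proof -
  let ?P = "\<lambda>k :: nat. k > 0 \<and> (\<exists>v. (v, int k) \<in> N)"
  have "\<not> inj (\<lambda>i :: nat. N #>\<^bsub>L\<^esub> (\<one>\<^bsub>base\<^esub>, int i))"
  proof
    assume "inj (\<lambda>i :: nat. N #>\<^bsub>L\<^esub> (\<one>\<^bsub>base\<^esub>, int i))"
    moreover have "range (\<lambda>i :: nat. N #>\<^bsub>L\<^esub> (\<one>\<^bsub>base\<^esub>, int i)) \<subseteq> rcosets\<^bsub>L\<^esub> N"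
      using L.rcosetsI[OF subgroup.subset[OF N]] by (auto simp: L_carrier)
    ultimately show False
      using fin finite_subset finite_imageD infinite_UNIV_nat by blast
  qed
  then obtain i j :: nat where ij: "i < j"
    "N #>\<^bsub>L\<^esub> (\<one>\<^bsub>base\<^esub>, int j) = N #>\<^bsub>L\<^esub> (\<one>\<^bsub>base\<^esub>, int i)"
    unfolding inj_def by (metis nat_neq_iff)
  then have "(\<one>\<^bsub>base\<^esub>, int j) \<otimes>\<^bsub>L\<^esub> inv\<^bsub>L\<^esub> (\<one>\<^bsub>base\<^esub>, int i) \<in> N"
    by (intro L.r_coset_eq_imp_mult_inv_mem[OF N]) (simp_all add: L_carrier)
  then have "(\<one>\<^bsub>base\<^esub>, int (j - i)) \<in> N"
    using ij(1) by (simp add: L_inv L_mult of_nat_diff)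
  then have "?P (j - i)"
    using ij(1) by auto
  then have least: "?P (LEAST k. ?P k)"
    by (rule LeastI)
  define k where "k = (LEAST k. ?P k)"
  obtain v where v: "k > 0" "(v, int k) \<in> N"
    using least unfolding k_def by blast
  have "int k dvd j" if u: "(u, j) \<in> N" for u j
  proof -
    \<comment> \<open>An element of degree \<open>- k (j div k)\<close> lowers the degree
      \<open>j\<close> to \<open>j mod k\<close>, which minimality of \<open>k\<close> forces to be
      0.\<close>
    obtain u' where "(u', int k * (- (j div int k))) \<in> N"
      using ex_multiple_degree[OF N v(2)] by blast
    then have "(u \<otimes>\<^bsub>base\<^esub> shift j u', j + int k * (- (j div int k))) \<in> N"
      using subgroup.m_closed[OF N u] by (fastforce simp: L_mult)
    then have "(u \<otimes>\<^bsub>base\<^esub> shift j u', int (nat (j mod int k))) \<in> N"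
      using v(1) by (simp add: minus_mult_div_eq_mod)
    moreover have "\<not> ?P (nat (j mod int k))"
      using v(1) unfolding k_def by (intro not_less_Least) (simp add: nat_less_iff flip: k_def)
    ultimately have "\<not> nat (j mod int k) > 0"
      by metis
    then have "j mod int k \<le> 0"
      by simp
    then have "j mod int k = 0"
      using v(1) by (intro antisym) simp_all
    then show ?thesis
      by (simp add: dvd_eq_mod_eq_0)
  qed
  with v show thesis by (rule that)
qed

text \<open>\<open>N\<close> is generated by its fibre and \<open>(w, k)\<close>: powers of
  \<open>(w, k)\<close>, taken inside \<open>N \<inter> N'\<close>, reach every degree of
  \<open>N\<close>, and elements of equal degree differ by an element of the fibre.\<close>

lemma subset_from_fibre:
  assumes N: "subgroup N L" and N': "subgroup N' L" and sub: "fibre N \<subseteq> fibre N'"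
    and w: "(w, k) \<in> N" "(w, k) \<in> N'" and dvd: "\<And>u j. (u, j) \<in> N \<Longrightarrow> k dvd j"
  shows "N \<subseteq> N'"
proof
  fix x assume x: "x \<in> N"
  obtain u j where uj: "x = (u, j)" by (cases x)
  then obtain q where q: "j = k * q"
    using dvd[of u j] x by (auto elim: dvdE)
  obtain v where v: "(v, j) \<in> N" "(v, j) \<in> N'"
    using ex_multiple_degree[OF L.subgroups_Inter_pair[OF N N'], of w k q] w q by auto
  have carr: "u \<in> carrier base" "v \<in> carrier base"
    using subgroup.subset[OF N] v(1) x uj by (auto simp: L_carrier)
  have "u \<otimes>\<^bsub>base\<^esub> inv\<^bsub>base\<^esub> v \<in> fibre N'"
    using mult_inv_fibre[OF N, of u j v] x uj v sub by blast
  then have "(u \<otimes>\<^bsub>base\<^esub> inv\<^bsub>base\<^esub> v, 0) \<otimes>\<^bsub>L\<^esub> (v, j) \<in> N'"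
    using v N' by (intro subgroup.m_closed) (simp_all add: fibre_def)
  then show "x \<in> N'"
    using carr by (simp add: L_mult uj base.m_assoc)
qed

text \<open>The elements \<open>(w, i)\<close> with \<open>w\<close> in \<open>W\<close> and
  \<open>0 \<le> i < k\<close> lie in distinct cosets: if two share a coset, \<open>k\<close>
  divides the difference of their degrees, so the degrees agree, and their quotient lies in
  \<open>W \<inter> fibre N\<close>.\<close>

lemma card_le_index:
  assumes N: "subgroup N L" and fin: "finite (rcosets\<^bsub>L\<^esub> N)"
    and dvd: "\<And>u j. (u, j) \<in> N \<Longrightarrow> int k dvd j"
    and W: "subgroup W base" and triv: "W \<inter> fibre N = {\<one>\<^bsub>base\<^esub>}"
  shows "k * card W \<le> card (rcosets\<^bsub>L\<^esub> N)"
proof -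
  have WB: "w \<in> carrier base" if "w \<in> W" for w
    using that subgroup.subset[OF W] by blast
  have "inj_on (\<lambda>x. N #>\<^bsub>L\<^esub> x) (W \<times> {0..<int k})"
  proof (rule inj_onI)
    fix x y assume x: "x \<in> W \<times> {0..<int k}" and y: "y \<in> W \<times> {0..<int k}"
      and eq: "N #>\<^bsub>L\<^esub> x = N #>\<^bsub>L\<^esub> y"
    obtain v i w j where xy: "x = (v, i)" "y = (w, j)" by (cases x, cases y)
    have vw: "v \<in> W" "w \<in> W" and ij: "0 \<le> i" "i < int k" "0 \<le> j" "j < int k"
      using x y by (auto simp: xy)
    have "x \<otimes>\<^bsub>L\<^esub> inv\<^bsub>L\<^esub> y \<in> N"
      using vw WB eq by (intro L.r_coset_eq_imp_mult_inv_mem[OF N]) (auto simp: xy L_carrier)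
    then have mem: "(v \<otimes>\<^bsub>base\<^esub> shift (i - j) (inv\<^bsub>base\<^esub> w), i - j) \<in> N"
      using vw WB by (simp add: xy L_inv L_mult)
    have "i = j"
      using dvd[OF mem] ij by (metis mod_eq_dvd_iff mod_pos_pos_trivial)
    with mem have "v \<otimes>\<^bsub>base\<^esub> inv\<^bsub>base\<^esub> w \<in> W \<inter> fibre N"
      using vw W by (simp add: fibre_def subgroup.m_closed subgroup.m_inv_closed)
    then have "v \<otimes>\<^bsub>base\<^esub> inv\<^bsub>base\<^esub> w = \<one>\<^bsub>base\<^esub>"
      by (simp add: triv)
    then show "x = y"
      using vw WB \<open>i = j\<close> by (simp add: xy) (metis base.inv_equality base.inv_closed base.inv_inv)
  qed
  moreover have "(\<lambda>x. N #>\<^bsub>L\<^esub> x) ` (W \<times> {0..<int k}) \<subseteq> rcosets\<^bsub>L\<^esub> N"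
    using WB L.rcosetsI[OF subgroup.subset[OF N]] by (auto simp: L_carrier)
  ultimately have "card (W \<times> {0..<int k}) \<le> card (rcosets\<^bsub>L\<^esub> N)"
    using fin by (rule card_inj_on_le)
  then show ?thesis
    by (simp add: card_cartesian_product mult.commute)
qed

subsection \<open>Encoding normal subgroups\<close>

text \<open>Take \<open>d\<close> with the largest sum among the independent boxes; the empty box is
  one of them and \<open>C\<close> bounds the sums. Raising a single entry would exceed the
  maximum.\<close>

lemma ex_maximal_box:
  assumes M: "subgroup M base"
    and bound: "\<And>d. supported (box d) \<inter> M = {\<one>\<^bsub>base\<^esub>} \<Longrightarrow> (\<Sum>l<n. d l) \<le> C"
  obtains d where "d \<in> extensional {..<n}" "supported (box d) \<inter> M = {\<one>\<^bsub>base\<^esub>}"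
    "\<And>l. l < n \<Longrightarrow> supported (box (d(l := Suc (d l)))) \<inter> M \<noteq> {\<one>\<^bsub>base\<^esub>}"
proof -
  let ?P = "\<lambda>s. \<exists>d. d \<in> extensional {..<n} \<and> supported (box d) \<inter> M = {\<one>\<^bsub>base\<^esub>} \<and> s = (\<Sum>l<n. d l)"
  have "supported (box (\<lambda>l\<in>{..<n}. 0)) \<subseteq> {\<one>\<^bsub>base\<^esub>}"
  proof
    fix f assume "f \<in> supported (box (\<lambda>l\<in>{..<n}. 0))"
    then have "f \<in> carrier base" "\<And>i l. l < n \<Longrightarrow> f i l = 0"
      by (auto simp: supported_def box_def) (meson not_less)
    then have "f = \<one>\<^bsub>base\<^esub>"
      by (intro base_eqI) (auto simp: base_one)
    then show "f \<in> {\<one>\<^bsub>base\<^esub>}" by simp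
  qed
  then have "supported (box (\<lambda>l\<in>{..<n}. 0)) \<inter> M = {\<one>\<^bsub>base\<^esub>}"
    using subgroup.one_closed[OF M] subgroup.one_closed[OF subgroup_supported] by blast
  then have "?P (\<Sum>l<n. (\<lambda>l\<in>{..<n}. 0) l)"
    by (intro exI[of _ "\<lambda>l\<in>{..<n}. 0"]) simp
  moreover have bdd: "s \<le> C" if "?P s" for s
    using bound that by blast
  ultimately have "?P (GREATEST s. ?P s)"
    by (rule GreatestI_nat)
  moreover have "s \<le> (GREATEST s. ?P s)" if "?P s" for s
    using that bdd by (rule Greatest_le_nat)
  ultimately obtain s where s: "?P s" "\<And>s'. ?P s' \<Longrightarrow> s' \<le> s"
    by blast
  then obtain d where d: "d \<in> extensional {..<n}" "supported (box d) \<inter> M = {\<one>\<^bsub>base\<^esub>}"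
    "s = (\<Sum>l<n. d l)" by blast
  have "supported (box (d(l := Suc (d l)))) \<inter> M \<noteq> {\<one>\<^bsub>base\<^esub>}" if l: "l < n" for l
  proof
    assume "supported (box (d(l := Suc (d l)))) \<inter> M = {\<one>\<^bsub>base\<^esub>}"
    moreover have "d(l := Suc (d l)) \<in> extensional {..<n}"
      using d(1) l by (auto simp: extensional_def)
    ultimately have "(\<Sum>j<n. (d(l := Suc (d l))) j) \<le> s"
      by (intro s(2)) blast
    moreover have "(\<Sum>j<n. d j) < (\<Sum>j<n. (d(l := Suc (d l))) j)"
      using l by (intro sum_strict_mono_ex1) auto
    ultimately show False
      using d(3) by simp
  qed
  with d show thesis by (intro that)
qed

text \<open>A nontrivial element of \<open>M\<close> in the enlarged box must involve the new
  monomial, since the old box meets \<open>M\<close> trivially. Scaling its coefficient there to 1,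
  possible as \<open>p\<close> is prime, and solving for the monomial gives
  \<open>r\<close>.\<close>

lemma ex_relation:
  assumes M: "subgroup M base" and l: "l < n"
    and triv: "supported (box d) \<inter> M = {\<one>\<^bsub>base\<^esub>}"
    and nontriv: "supported (box (d(l := Suc (d l)))) \<inter> M \<noteq> {\<one>\<^bsub>base\<^esub>}"
  obtains r where "r \<in> supported (box d)"
    "monomial (int (d l)) l \<otimes>\<^bsub>base\<^esub> inv\<^bsub>base\<^esub> r \<in> M"
proof -
  let ?Q = "insert (int (d l), l) (box d)"
  have Q: "box (d(l := Suc (d l))) = ?Q"
  proof (rule Set.set_eqI)
    fix x :: "int \<times> nat"
    obtain i j where "x = (i, j)" by (cases x)
    then show "x \<in> box (d(l := Suc (d l))) \<longleftrightarrow> x \<in> ?Q"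
      using l by (cases "j = l") (simp_all add: box_def, linarith)
  qed
  have "\<one>\<^bsub>base\<^esub> \<in> supported ?Q \<inter> M"
    using subgroup.one_closed[OF M] subgroup.one_closed[OF subgroup_supported] by blast
  then obtain f where f: "f \<in> supported ?Q" "f \<in> M" "f \<noteq> \<one>\<^bsub>base\<^esub>"
    using nontriv unfolding Q by blast
  have fB: "f \<in> carrier base"
    using f(1) supported_subset by blast
  define a where "a = f (int (d l)) l"
  have "a \<noteq> 0"
  proof
    assume "a = 0"
    then have "f \<in> supported (box d)"
      using f(1) by (auto simp: supported_def a_def)
    then show False
      using f triv by blast
  qed
  moreover have "0 \<le> a" "a < int p"
    using fB l by (auto simp: a_def base_carrier_iff)
  ultimately have "\<not> int p dvd a"
    by (auto dest: zdvd_imp_le)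
  moreover have "Factorial_Ring.prime (int p)"
    using prime_p by simp
  ultimately have "coprime a (int p)"
    by (metis coprime_commute prime_imp_coprime)
  \<comment> \<open>\<open>c\<close> inverts the leading coefficient modulo \<open>p\<close>; its
    residue becomes the exponent in \<open>g\<close>.\<close>
  then obtain c where "[a * c = 1] (mod int p)"
    using cong_solve_coprime_int by blast
  then have c: "(int (nat (c mod int p)) * a) mod int p = 1"
    using p_gt_1 by (simp add: cong_def mod_mult_right_eq mult.commute)
  define g where "g = f [^]\<^bsub>base\<^esub> nat (c mod int p)"
  have gB: "g \<in> carrier base"
    using fB by (simp add: g_def)
  have g: "g i j = (int (nat (c mod int p)) * f i j) mod int p" if "j < n" for i j
    unfolding g_def using fB that by (rule base_pow)
  have gM: "g \<in> M"
    using base.subgroup_int_pow_closed[OF M f(2), of "int (nat (c mod int p))"]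
    unfolding g_def int_pow_int .
  define r where "r = monomial (int (d l)) l \<otimes>\<^bsub>base\<^esub> inv\<^bsub>base\<^esub> g"
  have rB: "r \<in> carrier base"
    using gB by (simp add: r_def)
  have r: "r i j = (monomial (int (d l)) l i j - g i j) mod int p" if "j < n" for i j
    using that gB by (simp add: r_def base_mult base_inv mod_add_right_eq)
  have "r \<in> supported (box d)"
    unfolding supported_def
  proof (intro CollectI conjI allI impI)
    fix i j assume j: "j < n" and ne: "r i j \<noteq> 0"
    have ij: "(i, j) \<noteq> (int (d l), l)"
    proof
      assume "(i, j) = (int (d l), l)"
      then show False
        using ne r[OF j] g[OF j] c j by (simp add: a_def monomial_def)
    qed
    have "f i j \<noteq> 0"
    proof
      assume "f i j = 0"
      then have "g i j = 0"
        by (simp add: g[OF j])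
      moreover have "monomial (int (d l)) l i j = 0"
        using ij j by (simp add: monomial_def)
      ultimately show False
        using ne by (simp add: r[OF j])
    qed
    then have "(i, j) \<in> ?Q"
      using f(1) j by (simp add: supported_def)
    then show "(i, j) \<in> box d"
      using ij by blast
  qed (rule rB)
  moreover have "monomial (int (d l)) l \<otimes>\<^bsub>base\<^esub> inv\<^bsub>base\<^esub> r = g"
    using gB by (simp add: r_def base.inv_mult_group base.m_assoc[symmetric] base.m_comm[of g])
  ultimately show thesis
    using gM that by simp
qed

text \<open>If the top coefficients of \<open>w\<close> vanish, then \<open>x w\<close> still lies in \<open>W\<close>, so \<open>x w - w\<close> lies in
  \<open>W \<inter> M = 0\<close>; but no nonzero finitely supported sequence is shift invariant.\<close>

lemma shift_fixed_imp_one: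
  assumes w: "w \<in> supported (box d)" and top: "\<And>l. l < n \<Longrightarrow> w (int (d l) - 1) l = 0"
    and M: "shift 1 w \<otimes>\<^bsub>base\<^esub> inv\<^bsub>base\<^esub> w \<in> M"
    and triv: "supported (box d) \<inter> M = {\<one>\<^bsub>base\<^esub>}"
  shows "w = \<one>\<^bsub>base\<^esub>"
proof -
  note W = subgroup_supported[of "box d"]
  have wB: "w \<in> carrier base"
    using w supported_subset by blast
  have "shift 1 w \<in> supported (box d)"
    unfolding supported_def
  proof (intro CollectI conjI allI impI)
    fix i l assume l: "l < n" and "shift 1 w i l \<noteq> 0"
    then have ne: "w (i - 1) l \<noteq> 0"
      by (simp add: shift_def)
    then have "(i - 1, l) \<in> box d"
      using w l by (simp add: supported_def)
    moreover have "i - 1 \<noteq> int (d l) - 1"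
      using top[OF l] ne by metis
    ultimately show "(i, l) \<in> box d"
      by (simp add: box_def)
  qed (simp add: wB)
  then have "shift 1 w \<otimes>\<^bsub>base\<^esub> inv\<^bsub>base\<^esub> w \<in> supported (box d) \<inter> M"
    using w W M by (simp add: subgroup.m_closed subgroup.m_inv_closed)
  then have "shift 1 w = w"
    using triv wB by (metis base.inv_closed base.inv_equality base.inv_inv shift_carrier singletonD)
  then have step: "w i l = w (i - 1) l" for i l
    by (metis shift_def)
  have neg: "w i l = 0" if "l < n" "i < 0" for i l
    using w that by (auto simp: supported_def box_def) (meson not_less)
  have nonneg: "w (int i) l = 0" if "l < n" for i l
    by (induction i) (use that neg[of l "-1"] step[of 0 l] step[of "1 + int _" l] in auto)
  have "w i l = 0" if "l < n" for i l
    using nonneg[OF that, of "nat i"] neg[OF that, of i] by (cases "0 \<le> i") auto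
  then show ?thesis
    using wB by (intro base_eqI) (auto simp: base_one)
qed

text \<open>\<open>t\<close> lists the top coefficients of \<open>w\<close>; where \<open>d l = 0\<close>, the entry is the coefficient at
  \<open>-1\<close>, which vanishes.\<close>

definition encodes ::
  "nat \<times> (nat \<Rightarrow> nat) \<times> (nat \<Rightarrow> int \<Rightarrow> nat \<Rightarrow> int) \<times> (nat \<Rightarrow> int) \<Rightarrow>
    ((int \<Rightarrow> nat \<Rightarrow> int) \<times> int) set \<Rightarrow> bool" where
  "encodes = (\<lambda>(k, d, r, t) N.
     N \<lhd> L \<and> (\<forall>u j. (u, j) \<in> N \<longrightarrow> int k dvd j) \<and>
     supported (box d) \<inter> fibre N = {\<one>\<^bsub>base\<^esub>} \<and>
     (\<forall>l<n. r l \<in> supported (box d) \<and>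
        monomial (int (d l)) l \<otimes>\<^bsub>base\<^esub> inv\<^bsub>base\<^esub> (r l) \<in> fibre N) \<and>
     (\<exists>w \<in> supported (box d). (w, int k) \<in> N \<and> t = (\<lambda>l\<in>{..<n}. w (int (d l) - 1) l)))"

lemma ex_code:
  assumes N: "N \<lhd> L" and fin: "finite (rcosets\<^bsub>L\<^esub> N)"
  obtains k d r t where "encodes (k, d, r, t) N" "k > 0" "d \<in> extensional {..<n}"
    "r \<in> {..<n} \<rightarrow>\<^sub>E supported (box d)" "t \<in> {..<n} \<rightarrow>\<^sub>E {0..<int p}"
    "k * p ^ (\<Sum>l<n. d l) \<le> card (rcosets\<^bsub>L\<^esub> N)"
proof -
  note sub = normal_imp_subgroup[OF N]
  note M = subgroup_fibre[OF sub]
  obtain k v where k: "k > 0" and v: "(v, int k) \<in> N"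
    and dvd: "\<And>u j. (u, j) \<in> N \<Longrightarrow> int k dvd j"
    using ex_degree[OF sub fin] by blast
  have index: "k * p ^ (\<Sum>l<n. d l) \<le> card (rcosets\<^bsub>L\<^esub> N)"
    if "supported (box d) \<inter> fibre N = {\<one>\<^bsub>base\<^esub>}" for d
    using card_le_index[OF sub fin dvd subgroup_supported that] by (simp add: card_supported_box)
  \<comment> \<open>With \<open>D\<close> the sum, \<open>D < p^D \<le> k p^D\<close>, and the last
    is at most the index; this is the bound that a maximal box needs.\<close>
  have "(\<Sum>l<n. d l) \<le> card (rcosets\<^bsub>L\<^esub> N)"
    if "supported (box d) \<inter> fibre N = {\<one>\<^bsub>base\<^esub>}" for d
  proof -
    have "(\<Sum>l<n. d l) < p ^ (\<Sum>l<n. d l)"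
      using p_gt_1 by (simp add: power_gt_expt)
    also have "\<dots> \<le> k * p ^ (\<Sum>l<n. d l)"
      using k by simp
    finally show ?thesis
      using index[OF that] by simp
  qed
  then obtain d where d: "d \<in> extensional {..<n}" "supported (box d) \<inter> fibre N = {\<one>\<^bsub>base\<^esub>}"
    and max: "\<And>l. l < n \<Longrightarrow> supported (box (d(l := Suc (d l)))) \<inter> fibre N \<noteq> {\<one>\<^bsub>base\<^esub>}"
    using ex_maximal_box[OF M] by metis
  have "\<exists>r. l < n \<longrightarrow> r \<in> supported (box d) \<and>
      monomial (int (d l)) l \<otimes>\<^bsub>base\<^esub> inv\<^bsub>base\<^esub> r \<in> fibre N" for l
    using ex_relation[OF M _ d(2) max] by metis
  then obtain r0 where r0: "\<And>l. l < n \<Longrightarrow> r0 l \<in> supported (box d) \<and>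
      monomial (int (d l)) l \<otimes>\<^bsub>base\<^esub> inv\<^bsub>base\<^esub> (r0 l) \<in> fibre N"
    by metis
  define r where "r = (\<lambda>l\<in>{..<n}. r0 l)"
  have vB: "v \<in> carrier base"
    using v subgroup.subset[OF sub] by (auto simp: L_carrier)
  \<comment> \<open>\<open>x^a v\<close> has no negative exponents and, by normality, is still the
    first component of an element of \<open>N\<close> of degree \<open>k\<close>. Its remainder
    \<open>w\<close> modulo the fibre is the representative in \<open>W\<close>.\<close>
  obtain a where "shift (int a) v \<in> supported {x. 0 \<le> fst x}"
    using shift_supported_nonneg[OF vB] by blast
  then have "shift (int a) v \<in> supported (box d) <#>\<^bsub>base\<^esub> fibre N"
    using supported_nonneg_subset_set_mult[OF M, of r0 d] shift_fibre[OF N] r0 by blast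
  then obtain w g where w: "w \<in> supported (box d)" and g: "g \<in> fibre N"
    and wg: "shift (int a) v = w \<otimes>\<^bsub>base\<^esub> g"
    unfolding set_mult_def by blast
  have wB: "w \<in> carrier base" and gB: "g \<in> carrier base"
    using w g supported_subset subgroup.subset[OF M] by blast+
  have "(inv\<^bsub>base\<^esub> g, 0) \<otimes>\<^bsub>L\<^esub> (shift (int a) v, int k) \<in> N"
    using normal_shift[OF N v] subgroup.m_inv_closed[OF M g]
    by (intro subgroup.m_closed[OF sub]) (simp_all add: fibre_def)
  moreover have "inv\<^bsub>base\<^esub> g \<otimes>\<^bsub>base\<^esub> (w \<otimes>\<^bsub>base\<^esub> g) = w"
    using wB gB by (simp add: base.m_comm[of w] flip: base.m_assoc)
  ultimately have wN: "(w, int k) \<in> N"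
    by (simp add: L_mult wg)
  define t where "t = (\<lambda>l\<in>{..<n}. w (int (d l) - 1) l)"
  have "encodes (k, d, r, t) N"
    using N dvd d(2) r0 w wN by (auto simp: encodes_def r_def t_def)
  moreover have "r \<in> {..<n} \<rightarrow>\<^sub>E supported (box d)"
    using r0 by (auto simp: r_def)
  moreover have "t \<in> {..<n} \<rightarrow>\<^sub>E {0..<int p}"
    using wB by (auto simp: t_def base_carrier_iff)
  ultimately show thesis
    using k d(1) index[OF d(2)] by (intro that)
qed

text \<open>Both fibres satisfy the same relations, so division works modulo their intersection. For
  \<open>f\<close> in \<open>fibre N\<close>, the remainder of some \<open>x^a f\<close> lies in
  \<open>W \<inter> fibre N\<close> and vanishes; hence \<open>x^a f\<close> is in
  \<open>fibre N'\<close>, and shifting back gives \<open>f\<close>.\<close>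

lemma encodes_fibre_subset:
  assumes "encodes (k, d, r, t) N" "encodes (k, d, r, t') N'"
  shows "fibre N \<subseteq> fibre N'"
proof
  have N: "N \<lhd> L" and N': "N' \<lhd> L" and triv: "supported (box d) \<inter> fibre N = {\<one>\<^bsub>base\<^esub>}"
    using assms by (auto simp: encodes_def)
  note M = subgroup_fibre[OF normal_imp_subgroup[OF N]]
  note M' = subgroup_fibre[OF normal_imp_subgroup[OF N']]
  have K: "subgroup (fibre N \<inter> fibre N') base"
    using M M' by (rule base.subgroups_Inter_pair)
  have *: "supported {x. 0 \<le> fst x} \<subseteq> supported (box d) <#>\<^bsub>base\<^esub> (fibre N \<inter> fibre N')"
    using assms shift_fibre[OF N] shift_fibre[OF N']
    by (intro supported_nonneg_subset_set_mult[OF K, of r]) (auto simp: encodes_def)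
  fix f assume f: "f \<in> fibre N"
  then have fB: "f \<in> carrier base"
    using subgroup.subset[OF M] by blast
  obtain a where "shift (int a) f \<in> supported {x. 0 \<le> fst x}"
    using shift_supported_nonneg[OF fB] by blast
  then obtain w g where w: "w \<in> supported (box d)" and g: "g \<in> fibre N" "g \<in> fibre N'"
    and wg: "shift (int a) f = w \<otimes>\<^bsub>base\<^esub> g"
    using * unfolding set_mult_def by blast
  have wB: "w \<in> carrier base" and gB: "g \<in> carrier base"
    using w g supported_subset subgroup.subset[OF M] by blast+
  have "shift (int a) f \<otimes>\<^bsub>base\<^esub> inv\<^bsub>base\<^esub> g \<in> fibre N"
    using M shift_fibre[OF N f] g by (simp add: subgroup.m_closed subgroup.m_inv_closed)
  then have "w \<in> fibre N"
    using wB gB by (simp add: wg base.m_assoc)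
  then have "w = \<one>\<^bsub>base\<^esub>"
    using w triv by blast
  then have "shift (int a) f \<in> fibre N'"
    using g gB by (simp add: wg)
  then show "f \<in> fibre N'"
    using shift_fibre[OF N', of "shift (int a) f" "- int a"] by simp
qed

text \<open>The fibres agree, so it remains to see \<open>w = w'\<close>. Their difference has
  vanishing top coefficients and is sent into the fibre by \<open>x - 1\<close>, so it is trivial;
  the fibre and \<open>(w, k)\<close> then generate the same subgroup.\<close>

lemma encodes_inj:
  assumes "encodes (k, d, r, t) N" "encodes (k, d, r, t) N'"
  shows "N = N'"
proof -
  have N: "N \<lhd> L" and N': "N' \<lhd> L" and triv: "supported (box d) \<inter> fibre N = {\<one>\<^bsub>base\<^esub>}"
    and dvd: "\<And>u j. (u, j) \<in> N \<Longrightarrow> int k dvd j" "\<And>u j. (u, j) \<in> N' \<Longrightarrow> int k dvd j"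
    using assms by (auto simp: encodes_def)
  note sub = normal_imp_subgroup[OF N] and sub' = normal_imp_subgroup[OF N']
  note M = subgroup_fibre[OF sub]
  note W = subgroup_supported[of "box d"]
  have fib: "fibre N = fibre N'"
    using assms encodes_fibre_subset by blast
  obtain w where w: "w \<in> supported (box d)" "(w, int k) \<in> N"
    "t = (\<lambda>l\<in>{..<n}. w (int (d l) - 1) l)"
    using assms(1) by (auto simp: encodes_def)
  obtain w' where w': "w' \<in> supported (box d)" "(w', int k) \<in> N'"
    "t = (\<lambda>l\<in>{..<n}. w' (int (d l) - 1) l)"
    using assms(2) by (auto simp: encodes_def)
  have wB: "w \<in> carrier base" "w' \<in> carrier base"
    using w w' supported_subset by blast+
  define u where "u = w \<otimes>\<^bsub>base\<^esub> inv\<^bsub>base\<^esub> w'"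
  have "u = \<one>\<^bsub>base\<^esub>"
  proof (rule shift_fixed_imp_one[OF _ _ _ triv])
    show "u \<in> supported (box d)"
      using w(1) w'(1) W by (simp add: u_def subgroup.m_closed subgroup.m_inv_closed)
    show "u (int (d l) - 1) l = 0" if l: "l < n" for l
    proof -
      have "w (int (d l) - 1) l = w' (int (d l) - 1) l"
        using fun_cong[OF w(3)[unfolded w'(3)], of l] l by simp
      then show ?thesis
        using l wB by (simp add: u_def base_mult base_inv mod_add_right_eq)
    qed
    \<comment> \<open>By normality \<open>(x w, k)\<close> and \<open>(w, k)\<close> both lie in
      \<open>N\<close>, so their first components differ by an element of the fibre.\<close>
    have "shift 1 w \<otimes>\<^bsub>base\<^esub> inv\<^bsub>base\<^esub> w \<in> fibre N"
      by (rule mult_inv_fibre[OF sub normal_shift[OF N w(2)] w(2)])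
    moreover have "shift 1 w' \<otimes>\<^bsub>base\<^esub> inv\<^bsub>base\<^esub> w' \<in> fibre N"
      unfolding fib by (rule mult_inv_fibre[OF sub' normal_shift[OF N' w'(2)] w'(2)])
    ultimately have "(shift 1 w \<otimes>\<^bsub>base\<^esub> inv\<^bsub>base\<^esub> w) \<otimes>\<^bsub>base\<^esub>
        inv\<^bsub>base\<^esub> (shift 1 w' \<otimes>\<^bsub>base\<^esub> inv\<^bsub>base\<^esub> w') \<in> fibre N"
      using M by (simp add: subgroup.m_closed subgroup.m_inv_closed)
    then show "shift 1 u \<otimes>\<^bsub>base\<^esub> inv\<^bsub>base\<^esub> u \<in> fibre N"
      using wB by (simp add: u_def shift_mult shift_inv base.inv_mult base.m_ac)
  qed
  then have "w = w'"
    using wB unfolding u_def by (metis base.inv_closed base.inv_equality base.inv_inv)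
  then show ?thesis
    using subset_from_fibre[OF sub sub' _ w(2) _ dvd(1)]
      subset_from_fibre[OF sub' sub _ w'(2) _ dvd(2)] w(2) w'(2) fib
    by (simp add: subset_antisym)
qed

subsection \<open>Counting the codes\<close>

text \<open>The range of \<open>k\<close> reflects the index bound \<open>k p^D \<le> m\<close>. No
  entry of \<open>d\<close> exceeds the sum \<open>D\<close>, so the range \<open>{..D}\<close>
  loses nothing and makes the set finite.\<close>

definition codes ::
  "nat \<Rightarrow> nat \<Rightarrow> (nat \<times> (nat \<Rightarrow> nat) \<times> (nat \<Rightarrow> int \<Rightarrow> nat \<Rightarrow> int) \<times> (nat \<Rightarrow> int)) set" where
  "codes m D = {1..m div p ^ D} \<times>
     (SIGMA d:{d \<in> {..<n} \<rightarrow>\<^sub>E {..D}. (\<Sum>l<n. d l) = D}.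
        ({..<n} \<rightarrow>\<^sub>E supported (box d)) \<times> ({..<n} \<rightarrow>\<^sub>E {0..<int p}))"

lemma codes_card:
  assumes n: "n \<ge> 1"
  shows "finite (codes m D) \<and> card (codes m D) \<le> (D + 1) ^ n * p ^ n * m ^ n"
proof -
  let ?X = "{d \<in> {..<n} \<rightarrow>\<^sub>E {..D}. (\<Sum>l<n. d l) = D}"
  let ?Y = "\<lambda>d. ({..<n} \<rightarrow>\<^sub>E supported (box d)) \<times> ({..<n} \<rightarrow>\<^sub>E {0..<int p})"
  have finP: "finite ({..<n} \<rightarrow>\<^sub>E {..D})"
    by (simp add: finite_PiE)
  then have finX: "finite ?X"
    by simp
  have finY: "finite (?Y d)" for d
    by (simp add: finite_PiE card_supported_box)
  have "card ?X \<le> card ({..<n} \<rightarrow>\<^sub>E {..D})"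
    using finP by (intro card_mono) auto
  also have "\<dots> = (D + 1) ^ n"
    by (simp add: card_PiE)
  finally have cX: "card ?X \<le> (D + 1) ^ n" .
  have cY: "card (?Y d) = (p ^ D) ^ n * p ^ n" if "d \<in> ?X" for d
    using that by (simp add: card_cartesian_product card_PiE card_supported_box)
  have "card (Sigma ?X ?Y) = (\<Sum>d\<in>?X. card (?Y d))"
    using finX finY by (intro card_SigmaI) auto
  also have "\<dots> = card ?X * ((p ^ D) ^ n * p ^ n)"
    using cY by simp
  finally have "card (codes m D) = (m div p ^ D) * (card ?X * ((p ^ D) ^ n * p ^ n))"
    unfolding codes_def by (simp add: card_cartesian_product)
  also have "\<dots> \<le> (m div p ^ D) * ((D + 1) ^ n * ((p ^ D) ^ n * p ^ n))"
    using cX by (intro mult_le_mono) auto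
  also have "\<dots> = (m div p ^ D) * (p ^ D) ^ n * ((D + 1) ^ n * p ^ n)"
    by (simp only: mult_ac)
  \<comment> \<open>One of the \<open>n\<close> factors \<open>p^D\<close> is absorbed by
    \<open>m div p^D\<close>, and each of the others is at most \<open>m\<close>. For
    \<open>p^D > m\<close> the quotient is 0.\<close>
  also have "(m div p ^ D) * (p ^ D) ^ n \<le> m ^ n"
  proof (cases "p ^ D \<le> m")
    case True
    have "(m div p ^ D) * (p ^ D) ^ n = (m div p ^ D * p ^ D) * (p ^ D) ^ (n - 1)"
      using n by (cases n) simp_all
    also have "\<dots> \<le> m * m ^ (n - 1)"
      using True by (intro mult_le_mono power_mono) auto
    also have "\<dots> = m ^ n"
      using n by (cases n) simp_all
    finally show ?thesis .
  qed simp
  finally have "card (codes m D) \<le> m ^ n * ((D + 1) ^ n * p ^ n)"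
    by simp
  moreover have "finite (codes m D)"
    unfolding codes_def by (intro finite_SigmaI finX finY) simp
  ultimately show ?thesis
    by (simp add: mult_ac)
qed

text \<open>From \<open>2^D \<le> p^D \<le> m < 2^C\<close> follows \<open>D < C\<close>, so only
  \<open>C\<close> values of \<open>D\<close> occur. Summing over them supplies one more factor
  \<open>C\<close> besides the bound \<open>C^n\<close> for \<open>(D + 1)^n\<close>.\<close>

lemma normal_subgroups_bound:
  assumes n: "n \<ge> 1" and m: "m < 2 ^ C"
  shows "finite (normal_subgroups_index_le L m) \<and>
    card (normal_subgroups_index_le L m) \<le> C ^ Suc n * p ^ n * m ^ n"
proof -
  let ?X = "\<Union>D<C. codes m D"
  have finX: "finite ?X"
    using codes_card[OF n] by blast
  have ex: "\<exists>x\<in>?X. encodes x N" if "N \<in> normal_subgroups_index_le L m" for N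
  proof -
    have N: "N \<lhd> L" "finite (rcosets\<^bsub>L\<^esub> N)" "card (rcosets\<^bsub>L\<^esub> N) \<le> m"
      using that by (auto simp: normal_subgroups_index_le_def)
    obtain k d r t where c: "encodes (k, d, r, t) N" "k > 0" "d \<in> extensional {..<n}"
      "r \<in> {..<n} \<rightarrow>\<^sub>E supported (box d)" "t \<in> {..<n} \<rightarrow>\<^sub>E {0..<int p}"
      and le: "k * p ^ (\<Sum>l<n. d l) \<le> card (rcosets\<^bsub>L\<^esub> N)"
      using ex_code[OF N(1,2)] by metis
    define D where "D = (\<Sum>l<n. d l)"
    have kD: "k * p ^ D \<le> m"
      using le N(3) by (simp add: D_def)
    have "2 ^ D \<le> p ^ D"
      using p_gt_1 by (intro power_mono) auto
    also have "\<dots> \<le> k * p ^ D"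
      using c(2) by simp
    finally have "(2 :: nat) ^ D < 2 ^ C"
      using kD m by linarith
    then have "D < C"
      by (rule power_less_imp_less_exp[rotated]) simp
    moreover have "d \<in> {..<n} \<rightarrow>\<^sub>E {..D}"
    proof (rule PiE_I)
      fix l assume "l \<in> {..<n}"
      then show "d l \<in> {..D}"
        unfolding D_def by (auto intro: member_le_sum)
    qed (use c(3) in \<open>auto simp: extensional_def\<close>)
    moreover have "k \<le> m div p ^ D"
      using kD p_gt_1 by (simp add: less_eq_div_iff_mult_less_eq)
    ultimately have "(k, d, r, t) \<in> ?X"
      using c by (auto simp: codes_def D_def)
    then show ?thesis
      using c(1) by blast
  qed
  have unique: "y = z" if "encodes x y" "encodes x z" for x y z
    using that encodes_inj by (cases x) blast
  have "finite (normal_subgroups_index_le L m) \<and> card (normal_subgroups_index_le L m) \<le> card ?X"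
    by (rule finite_card_le_of_relation[of ?X _ encodes]) (fact finX ex unique)+
  then have fin: "finite (normal_subgroups_index_le L m)"
    and card: "card (normal_subgroups_index_le L m) \<le> card ?X"
    by (rule conjunct1, rule conjunct2)
  have "card ?X \<le> (\<Sum>D<C. card (codes m D))"
    by (rule card_UN_le) simp
  also have "\<dots> \<le> (\<Sum>D<C. C ^ n * p ^ n * m ^ n)"
  proof (rule sum_mono)
    fix D assume "D \<in> {..<C}"
    then have "(D + 1) ^ n * p ^ n * m ^ n \<le> C ^ n * p ^ n * m ^ n"
      by (intro mult_le_mono power_mono) auto
    then show "card (codes m D) \<le> C ^ n * p ^ n * m ^ n"
      using codes_card[OF n, of m D] by linarith
  qed
  also have "\<dots> = C ^ Suc n * p ^ n * m ^ n"
    by simp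
  finally show ?thesis
    using fin card by simp
qed

section \<open>Logarithmic growth of the count\<close>

lemma log_normal_subgroup_count_le:
  assumes n: "n \<ge> 1" and m: "m \<ge> 2"
  shows "ln (real (normal_subgroup_count L m)) / ln (real m) \<le>
    ((real n + 1) * ln (log 2 (real m) + 1) + real n * ln (real p) + real n * ln (real m)) / ln (real m)"
proof (rule divide_right_mono)
  \<comment> \<open>The number of binary digits of \<open>m\<close>, hence the least
    \<open>C\<close> with \<open>m < 2^C\<close>.\<close>
  define C where "C = nat \<lfloor>log 2 (real m)\<rfloor> + 1"
  have log: "0 \<le> log 2 (real m)"
    using m by simp
  have C: "real C \<le> log 2 (real m) + 1" "log 2 (real m) < real C" "1 \<le> C"
    using log by (simp_all add: C_def) linarith
  have "real m = 2 powr log 2 (real m)"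
    using m by simp
  also have "\<dots> < 2 powr real C"
    using C by simp
  finally have "m < 2 ^ C"
    by (simp add: powr_realpow)
  then have "normal_subgroup_count L m \<le> C ^ Suc n * p ^ n * m ^ n"
    using normal_subgroups_bound[OF n] by (simp add: normal_subgroup_count_def)
  moreover have pos: "C ^ Suc n * p ^ n * m ^ n \<ge> 1"
    using C(3) m p_gt_1 by (simp add: Suc_le_eq)
  ultimately have "ln (real (normal_subgroup_count L m)) \<le> ln (real (C ^ Suc n * p ^ n * m ^ n))"
    by (rule ln_real_nat_mono)
  also have "\<dots> = (real n + 1) * ln (real C) + real n * ln (real p) + real n * ln (real m)"
    using C(3) m p_gt_1 by (simp add: ln_mult ln_realpow algebra_simps)
  also have "ln (real C) \<le> ln (log 2 (real m) + 1)"
    using C by simp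
  finally show "ln (real (normal_subgroup_count L m)) \<le>
    (real n + 1) * ln (log 2 (real m) + 1) + real n * ln (real p) + real n * ln (real m)"
    by (simp add: mult_left_mono)
qed (use m in simp)

end

text \<open>Finiteness is asserted as well because \<open>card\<close> gives 0 on infinite sets, so
  that the growth bound speaks of a genuine count.\<close>

theorem corollary3p19:
  fixes p n :: nat
  assumes "Factorial_Ring.prime p" and "n \<ge> 1"
  shows "(\<forall>m. finite (normal_subgroups_index_le (lamplighter p n) m)) \<and>
    limsup (\<lambda>m. ereal (ln (real (normal_subgroup_count (lamplighter p n) m)) / ln (real m))) \<le> ereal (real n)"
proof
  interpret prime_lamplighter p n
    using assms(1) by unfold_locales
  show "\<forall>m. finite (normal_subgroups_index_le (lamplighter p n) m)"
    \<comment> \<open>For finiteness alone the exponent \<open>C = m\<close> will do, as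
      \<open>m < 2^m\<close>.\<close>
    using normal_subgroups_bound[OF assms(2) less_exp] by blast
  let ?b = "\<lambda>m::nat. ((real n + 1) * ln (log 2 (real m) + 1) + real n * ln (real p) +
    real n * ln (real m)) / ln (real m)"
  \<comment> \<open>Divided by \<open>ln m\<close>, the iterated logarithm and the constant tend to
    0, leaving \<open>n\<close>.\<close>
  have "?b \<longlonglongrightarrow> real n"
    by real_asymp
  then have "limsup (\<lambda>m. ereal (?b m)) = ereal (real n)"
    by (intro lim_imp_Limsup) simp_all
  moreover have "limsup (\<lambda>m. ereal (ln (real (normal_subgroup_count L m)) / ln (real m)))
      \<le> limsup (\<lambda>m. ereal (?b m))"
    using log_normal_subgroup_count_le[OF assms(2)]
    by (intro Limsup_mono eventually_sequentiallyI[of 2]) simp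
  ultimately show "limsup (\<lambda>m. ereal (ln (real (normal_subgroup_count L m)) / ln (real m))) \<le> ereal (real n)"
    by simp
qed

end
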